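(* Let $E$ be a uniformly smooth and uniformly convex real Banach space with dual $E^*$, let $p>1$, and let $J_p:E\to E^*$ be the generalized duality mapping. Suppose $A:E\to 2^{E^*}$ with $D(A)=E$ is a multivalued generalized $\Phi$-strongly monotone mapping such that $R(J_p+t_0A)=E^*$ for some $t_0>0$. Then $A$ satisfies the range condition, that is, $R(J_p+tA)=E^*$ for all $t>0$.
   Context: For $p>1$, the generalized duality mapping $J_p:E\to 2^{E^*}$ is $J_p(x)=\{f\in E^*:\langle x,f\rangle=\|x\|\,\|f\|,\ \|f\|=\|x\|^{p-1}\}$; it is single-valued when $E$ is smooth. $D(A)=\{x\in E: Ax\neq\emptyset\}$ is the domain and $R(\cdot)$ the range (the union of all values). A multivalued mapping $A$ is generalized $\Phi$-strongly monotone if there exists a strictly increasing function $\Phi:[0,\infty)\to[0,\infty)$ with $\Phi(0)=0$ such that for all $x,y\in D(A)$, $\langle\mu-\nu,x-y\rangle\ge\Phi(\|x-y\|)$ for all $\mu\in Ax$, $\nu\in Ay$. *)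

theory Defs
  imports "HOL-Analysis.Analysis"
begin

text \<open>
  The dual of a real normed space \<open>'a\<close> is the type \<open>'a \<Rightarrow>\<^sub>L real\<close> of bounded linear
  functionals with the operator norm; the pairing of \<open>x\<close> with \<open>f\<close> is \<open>blinfun_apply f x\<close>.
  A multivalued mapping from \<open>'a\<close> to its dual is a set-valued function.
\<close>

definition uniformly_convex_space :: "'a::real_normed_vector itself \<Rightarrow> bool" where
  "uniformly_convex_space _ \<longleftrightarrow>
     (\<forall>\<epsilon>. 0 < \<epsilon> \<and> \<epsilon> \<le> 2 \<longrightarrow>
        (\<exists>\<delta>>0. \<forall>x y :: 'a. norm x = 1 \<and> norm y = 1 \<and> norm (x - y) \<ge> \<epsilon> \<longrightarrow>
           norm ((1/2) *\<^sub>R (x + y)) \<le> 1 - \<delta>))"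

text \<open>
  The following says that the modulus of smoothness
  \<open>\<rho>(\<tau>) = sup {(\<parallel>x + y\<parallel> + \<parallel>x - y\<parallel>)/2 - 1 | \<parallel>x\<parallel> = 1, \<parallel>y\<parallel> = \<tau>}\<close> satisfies
  \<open>\<rho>(\<tau>)/\<tau> \<rightarrow> 0\<close> as \<open>\<tau> \<rightarrow> 0+\<close>. Unfolding the supremum avoids an
  unspecified value on the zero space, where the set is empty.
\<close>

definition uniformly_smooth_space :: "'a::real_normed_vector itself \<Rightarrow> bool" where
  "uniformly_smooth_space _ \<longleftrightarrow>
     (\<forall>\<epsilon>>0. \<exists>\<delta>>0. \<forall>x y :: 'a. norm x = 1 \<and> norm y \<le> \<delta> \<longrightarrow>
        (norm (x + y) + norm (x - y)) / 2 - 1 \<le> \<epsilon> * norm y)"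

text \<open>For \<open>p > 1\<close>, \<open>0 powr (p - 1) = 0\<close> is the intended value at \<open>x = 0\<close>.\<close>

definition duality_map :: "real \<Rightarrow> 'a::real_normed_vector \<Rightarrow> ('a \<Rightarrow>\<^sub>L real) set" where
  "duality_map p x =
     {f. blinfun_apply f x = norm x * norm f \<and> norm f = norm x powr (p - 1)}"

definition mv_domain :: "('a \<Rightarrow> 'b set) \<Rightarrow> 'a set" where
  "mv_domain A = {x. A x \<noteq> {}}"

definition mv_range :: "('a \<Rightarrow> 'b set) \<Rightarrow> 'b set" where
  "mv_range A = (\<Union>x. A x)"

definition mv_add :: "('a \<Rightarrow> 'b::plus set) \<Rightarrow> ('a \<Rightarrow> 'b set) \<Rightarrow> 'a \<Rightarrow> 'b set" where
  "mv_add A B x = {f + g | f g. f \<in> A x \<and> g \<in> B x}"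

definition mv_scale :: "real \<Rightarrow> ('a \<Rightarrow> 'b::real_vector set) \<Rightarrow> 'a \<Rightarrow> 'b set" where
  "mv_scale t A x = {t *\<^sub>R f | f. f \<in> A x}"

definition gen_Phi_strongly_monotone ::
    "('a::real_normed_vector \<Rightarrow> ('a \<Rightarrow>\<^sub>L real) set) \<Rightarrow> bool" where
  "gen_Phi_strongly_monotone A \<longleftrightarrow>
     (\<exists>\<Phi> :: real \<Rightarrow> real.
        \<Phi> ` {0..} \<subseteq> {0..} \<and> strict_mono_on {0..} \<Phi> \<and> \<Phi> 0 = 0 \<and>
        (\<forall>x \<in> mv_domain A. \<forall>y \<in> mv_domain A. \<forall>\<mu> \<in> A x. \<forall>\<nu> \<in> A y.
           blinfun_apply (\<mu> - \<nu>) (x - y) \<ge> \<Phi> (norm (x - y))))"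

text \<open>The range condition is relative to the exponent \<open>p\<close> of the duality mapping.\<close>

definition range_condition ::
    "real \<Rightarrow> ('a::real_normed_vector \<Rightarrow> ('a \<Rightarrow>\<^sub>L real) set) \<Rightarrow> bool" where
  "range_condition p A \<longleftrightarrow>
     (\<forall>t>0. mv_range (mv_add (duality_map p) (mv_scale t A)) = UNIV)"

end

theory Submission
  imports Defs
begin

text \<open>
  The equation \<open>f \<in> J\<^sub>p x + t A x\<close> is the optimality condition of the variational inequality
  \<open>\<langle>t \<nu> - f, y - x\<rangle> + \<parallel>y\<parallel>\<^sup>p/p - \<parallel>x\<parallel>\<^sup>p/p \<ge> 0\<close> for all \<open>y\<close> and \<open>\<nu> \<in> A y\<close>. Each pair \<open>(y, \<nu>)\<close> restricts \<open>x\<close>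
  to a closed convex set, bounded for \<open>y = 0\<close>. Finitely many of these sets meet by a minimax
  argument based on monotonicity, so all of them meet by uniform convexity. Testing with
  \<open>y = x + s v\<close> and letting \<open>s \<rightarrow> 0\<close>, which uses \<open>D(A) = E\<close> and the differentiability of the norm,
  shows that \<open>(f - J\<^sub>p x)/t\<close> is monotonically related to the graph of \<open>A\<close>. It then belongs to \<open>A x\<close>,
  since surjectivity of \<open>J\<^sub>p + t\<^sub>0 A\<close> and strict monotonicity of \<open>J\<^sub>p\<close> make \<open>A\<close> maximal monotone.
\<close>

section \<open>Convexity of powers of the norm\<close>

text \<open>For positive arguments this is \<open>powr_convex\<close>. If one argument is 0, the
  claim reduces to \<open>t powr p \<le> t\<close> for \<open>t\<close> between 0 and 1.\<close>

lemma powr_convex_on_nonneg: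
  fixes p :: real
  assumes "1 \<le> p"
  shows "convex_on {0..} (\<lambda>r. r powr p)"
proof (rule convex_onI)
  have shrink: "(t * r) powr p \<le> t * r powr p" if "0 < t" "t < 1" "0 \<le> r" for t r :: real
  proof -
    have "t powr p \<le> t powr 1"
      using that assms by (intro powr_mono') auto
    then show ?thesis
      using that by (simp add: powr_mult mult_right_mono)
  qed
  fix t x y :: real
  assume t: "0 < t" "t < 1" and "x \<in> {0..}" "y \<in> {0..}"
  then have xy: "0 \<le> x" "0 \<le> y" by auto
  show "((1 - t) *\<^sub>R x + t *\<^sub>R y) powr p \<le> (1 - t) * x powr p + t * y powr p"
  proof (cases "x = 0 \<or> y = 0")
    case True
    then show ?thesis
      using shrink[of t y] shrink[of "1 - t" x] t xy assms by auto
  next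
    case False
    then show ?thesis
      using convex_onD[OF powr_convex[OF assms], of t x y] t xy by auto
  qed
qed simp

lemma norm_powr_convex:
  assumes "1 \<le> p"
  shows "convex_on UNIV (\<lambda>x::'a::real_normed_vector. norm x powr p)"
proof (rule convex_onI)
  fix t :: real and x y :: 'a
  assume t: "0 < t" "t < 1"
  have "norm ((1 - t) *\<^sub>R x + t *\<^sub>R y) \<le> (1 - t) * norm x + t * norm y"
    using norm_triangle_ineq[of "(1 - t) *\<^sub>R x" "t *\<^sub>R y"] t by simp
  then have "norm ((1 - t) *\<^sub>R x + t *\<^sub>R y) powr p \<le> ((1 - t) * norm x + t * norm y) powr p"
    using assms by (intro powr_mono2) auto
  also have "\<dots> \<le> (1 - t) * norm x powr p + t * norm y powr p"
    using convex_onD[OF powr_convex_on_nonneg[OF assms], of t "norm x" "norm y"] t by simp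
  finally show "norm ((1 - t) *\<^sub>R x + t *\<^sub>R y) powr p \<le> (1 - t) * norm x powr p + t * norm y powr p" .
qed simp

section \<open>A minimax statement on the simplex\<close>

text \<open>
  A minimizer over the simplex of the sum of the squared negative parts of the row values
  has all negative parts zero: otherwise these negative parts, normalized to a point of the
  simplex, would give a descent direction.
\<close>

lemma simplex_solution:
  fixes M :: "'i \<Rightarrow> 'i \<Rightarrow> real"
  assumes I: "finite I" "I \<noteq> {}"
    and skew: "\<And>i j. i \<in> I \<Longrightarrow> j \<in> I \<Longrightarrow> 0 \<le> M i j + M j i"
  shows "\<exists>l. (\<forall>i\<in>I. 0 \<le> l i) \<and> sum l I = 1 \<and> (\<forall>i\<in>I. 0 \<le> (\<Sum>j\<in>I. M i j * l j))"
proof -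
  \<comment> \<open>Coordinates outside \<open>I\<close> are pinned to 0, so the simplex is a closed
    subset of a product of compact sets, and Tychonoff's theorem makes it compact for any index
    type.\<close>
  define \<Delta> where "\<Delta> = PiE UNIV (\<lambda>i. if i \<in> I then {0..1::real} else {0}) \<inter> {l. sum l I = 1}"
  define row where "row l i = (\<Sum>j\<in>I. M i j * l j)" for l :: "'i \<Rightarrow> real" and i
  define F where "F l = (\<Sum>i\<in>I. (min 0 (row l i))\<^sup>2)" for l
  have \<Delta>I: "(\<lambda>i. if i \<in> I then m i else 0) \<in> \<Delta>"
    if "\<And>i. i \<in> I \<Longrightarrow> 0 \<le> m i" "sum m I = 1" for m :: "'i \<Rightarrow> real"
  proof -
    have "m i \<le> 1" if "i \<in> I" for i
      using member_le_sum[of i I m] that \<open>\<And>i. i \<in> I \<Longrightarrow> 0 \<le> m i\<close> \<open>sum m I = 1\<close> I by auto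
    then show ?thesis
      using that I by (auto simp: \<Delta>_def PiE_iff)
  qed
  have cont: "continuous_on S (\<lambda>l. sum (\<lambda>i. c i * l i) I)" for S and c :: "'i \<Rightarrow> real"
    by (intro continuous_intros continuous_on_subset[OF continuous_on_product_coordinates]) auto
  have "compact \<Delta>"
    unfolding \<Delta>_def
  proof (rule compact_Int_closed)
    have "compactin (product_topology (\<lambda>_. euclidean) UNIV)
        (PiE UNIV (\<lambda>i::'i. if i \<in> I then {0..1::real} else {0}))"
      by (subst compactin_PiE) auto
    then show "compact (PiE UNIV (\<lambda>i::'i. if i \<in> I then {0..1::real} else {0}))"
      by (simp add: euclidean_product_topology)
    show "closed {l::'i \<Rightarrow> real. sum l I = 1}"
      using cont[of UNIV "\<lambda>_. 1"] by (intro closed_Collect_eq continuous_intros) auto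
  qed
  moreover obtain i0 where "i0 \<in> I" using I by auto
  then have "\<Delta> \<noteq> {}"
    using \<Delta>I[of "\<lambda>i. if i = i0 then 1 else 0"] I by force
  moreover have "continuous_on \<Delta> F"
    unfolding F_def row_def by (intro continuous_intros cont)
  ultimately obtain l where l: "l \<in> \<Delta>" and lmin: "\<And>m. m \<in> \<Delta> \<Longrightarrow> F l \<le> F m"
    using continuous_attains_inf[of \<Delta> F] by blast
  have l1: "\<And>i. i \<in> I \<Longrightarrow> 0 \<le> l i" "\<And>i. i \<notin> I \<Longrightarrow> l i = 0" "sum l I = 1"
    using l by (auto simp: \<Delta>_def PiE_iff split: if_splits)
  define w where "w i = min 0 (row l i)" for i
  have "F l = 0"
  proof (rule ccontr)
    assume "F l \<noteq> 0"
    then have Fpos: "0 < F l"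
      unfolding F_def by (simp add: less_le sum_nonneg)
    have wle: "w i \<le> 0" for i by (simp add: w_def)
    define W where "W = - sum w I"
    have "W \<noteq> 0"
    proof
      assume "W = 0"
      then have "(\<Sum>i\<in>I. - w i) = 0" by (simp add: W_def sum_negf)
      then have "\<forall>i\<in>I. w i = 0"
        using I wle by (subst (asm) sum_nonneg_eq_0_iff) auto
      then show False using Fpos by (simp add: F_def w_def)
    qed
    moreover have "0 \<le> W" unfolding W_def using wle by (simp add: sum_nonpos)
    ultimately have W: "0 < W" by simp
    define m where "m i = (if i \<in> I then - w i / W else 0)" for i
    have m: "m \<in> \<Delta>" "\<And>i. i \<in> I \<Longrightarrow> 0 \<le> m i" "sum m I = 1"
    proof -
      have s: "(\<Sum>i\<in>I. - w i / W) = 1"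
        using W by (simp add: W_def sum_divide_distrib[symmetric] sum_negf)
      show "m \<in> \<Delta>"
        unfolding m_def using s wle W by (intro \<Delta>I) (auto simp: divide_nonpos_pos)
      show "\<And>i. i \<in> I \<Longrightarrow> 0 \<le> m i" using wle W by (simp add: m_def divide_nonpos_pos)
      show "sum m I = 1" using s by (simp add: m_def)
    qed
    define b where "b i = row m i - row l i" for i
    \<comment> \<open>First-order optimality of \<open>l\<close> along the segment from
      \<open>l\<close> to \<open>m\<close>, with the factor \<open>s\<close> already divided
      out.\<close>
    have var: "0 \<le> 2 * (\<Sum>i\<in>I. w i * b i) + s * (\<Sum>i\<in>I. (b i)\<^sup>2)" if s: "0 < s" "s \<le> 1" for s
    proof -
      define k where "k i = (if i \<in> I then (1 - s) * l i + s * m i else 0)" for i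
      have "k \<in> \<Delta>"
        unfolding k_def using l1 m s
        by (intro \<Delta>I) (auto simp: sum.distrib sum_distrib_left[symmetric])
      have row: "row k i = row l i + s * b i" for i
      proof -
        have "row k i = (\<Sum>j\<in>I. (1 - s) * (M i j * l j) + s * (M i j * m j))"
          unfolding row_def by (intro sum.cong) (auto simp: k_def algebra_simps)
        also have "\<dots> = (1 - s) * row l i + s * row m i"
          by (simp add: row_def sum.distrib sum_distrib_left)
        finally show ?thesis by (simp add: b_def algebra_simps)
      qed
      \<comment> \<open>The right-hand side is a quadratic polynomial in \<open>s\<close> that
        dominates the squared negative part and agrees with it at \<open>s = 0\<close>. It takes the
        place of differentiating the negative part.\<close>
      have neg: "(min 0 (row k i))\<^sup>2 \<le> (w i + s * b i)\<^sup>2" for i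
        unfolding row w_def by (rule abs_le_square_iff[THEN iffD1]) (auto simp: min_def)
      have "F l \<le> F k" using lmin \<open>k \<in> \<Delta>\<close> by blast
      also have "\<dots> \<le> (\<Sum>i\<in>I. (w i + s * b i)\<^sup>2)"
        unfolding F_def by (intro sum_mono neg)
      also have "\<dots> = (\<Sum>i\<in>I. (w i)\<^sup>2 + s * (2 * (w i * b i) + s * (b i)\<^sup>2))"
        by (intro sum.cong) (auto simp: power2_eq_square algebra_simps)
      also have "\<dots> = F l + s * (2 * (\<Sum>i\<in>I. w i * b i) + s * (\<Sum>i\<in>I. (b i)\<^sup>2))"
        by (simp only: F_def w_def sum.distrib sum_distrib_left[symmetric])
      finally show ?thesis using s by (simp add: zero_le_mult_iff)
    qed
    have "((\<lambda>s. 2 * (\<Sum>i\<in>I. w i * b i) + s * (\<Sum>i\<in>I. (b i)\<^sup>2)) \<longlongrightarrow>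
        2 * (\<Sum>i\<in>I. w i * b i) + 0 * (\<Sum>i\<in>I. (b i)\<^sup>2)) (at_right 0)"
      by (intro tendsto_intros)
    moreover have "\<forall>\<^sub>F s in at_right 0. 0 \<le> 2 * (\<Sum>i\<in>I. w i * b i) + s * (\<Sum>i\<in>I. (b i)\<^sup>2)"
      by (rule eventually_at_rightI[of 0 1]) (simp_all add: var)
    ultimately have "0 \<le> 2 * (\<Sum>i\<in>I. w i * b i) + 0 * (\<Sum>i\<in>I. (b i)\<^sup>2)"
      by (rule tendsto_lowerbound) simp
    then have "0 \<le> (\<Sum>i\<in>I. w i * b i)" by simp
    moreover have "(\<Sum>i\<in>I. w i * row l i) = F l"
      unfolding F_def w_def by (intro sum.cong) (auto simp: min_def power2_eq_square)
    ultimately have le: "F l \<le> (\<Sum>i\<in>I. w i * row m i)"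
      by (simp add: b_def algebra_simps sum_subtractf)
    \<comment> \<open>The hypothesis \<open>skew\<close> makes the quadratic form of
      \<open>M\<close> nonnegative at \<open>m\<close>. Since \<open>m = - w / W\<close> on
      \<open>I\<close>, the bound \<open>le\<close> makes the same form at most
      \<open>- F l / W\<close>, which is negative.\<close>
    have "0 \<le> (\<Sum>i\<in>I. \<Sum>j\<in>I. m i * m j * (M i j + M j i))"
      using m skew by (intro sum_nonneg mult_nonneg_nonneg) auto
    also have "\<dots> = (\<Sum>i\<in>I. \<Sum>j\<in>I. m i * m j * M i j) + (\<Sum>i\<in>I. \<Sum>j\<in>I. m i * m j * M j i)"
      by (simp add: algebra_simps sum.distrib)
    also have "(\<Sum>i\<in>I. \<Sum>j\<in>I. m i * m j * M j i) = (\<Sum>i\<in>I. \<Sum>j\<in>I. m i * m j * M i j)"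
      by (subst sum.swap) (simp add: mult.commute)
    finally have "0 \<le> (\<Sum>i\<in>I. \<Sum>j\<in>I. m i * m j * M i j)" by simp
    also have "\<dots> = (\<Sum>i\<in>I. m i * row m i)"
      by (simp add: row_def sum_distrib_left mult_ac)
    also have "\<dots> = - (\<Sum>i\<in>I. w i * row m i) / W"
      by (simp add: m_def sum_divide_distrib sum_negf)
    finally show False using le Fpos W by (simp add: field_simps)
  qed
  then have "\<forall>i\<in>I. min 0 (row l i) = 0"
    unfolding F_def using I by (simp add: sum_nonneg_eq_0_iff)
  then have "\<forall>i\<in>I. 0 \<le> row l i" by (auto simp: min_def split: if_splits)
  then show ?thesis using l1 unfolding row_def by blast
qed

section \<open>Uniform convexity and intersections of convex sets\<close>

text \<open>Radial projection onto the sphere of radius \<open>a\<close> moves each of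
  \<open>x\<close> and \<open>y\<close> by at most \<open>b - a\<close>. If the directions were far
  apart, the midpoint would have norm at most \<open>a * (1 - d) + (b - a)\<close>, which is less
  than \<open>a\<close>.\<close>

lemma uniformly_convex_near_norm:
  assumes uc: "uniformly_convex_space TYPE('a::real_normed_vector)" and "0 < e"
  shows "\<exists>d>0. \<forall>a b. \<forall>x y::'a. 0 < a \<and> a \<le> norm x \<and> norm x \<le> b \<and> a \<le> norm y \<and> norm y \<le> b
    \<and> a \<le> norm ((1/2) *\<^sub>R (x + y)) \<and> b - a < a * d \<longrightarrow> norm (x - y) \<le> a * e + 2 * (b - a)"
proof -
  \<comment> \<open>The definition of uniform convexity only speaks of separations up to 2.\<close>
  define e' where "e' = min e 2"
  have "0 < e' \<and> e' \<le> 2" using assms by (auto simp: e'_def)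
  with uc obtain d where d: "0 < d" and dd: "\<forall>x y::'a. norm x = 1 \<and> norm y = 1 \<and> norm (x - y) \<ge> e'
      \<longrightarrow> norm ((1/2) *\<^sub>R (x + y)) \<le> 1 - d"
    unfolding uniformly_convex_space_def by (auto simp only:)
  have "norm (x - y) \<le> a * e + 2 * (b - a)"
    if a: "0 < a" and x: "a \<le> norm x" "norm x \<le> b" and y: "a \<le> norm y" "norm y \<le> b"
      and mid: "a \<le> norm ((1/2) *\<^sub>R (x + y))" and ba: "b - a < a * d" for a b and x y :: 'a
  proof -
    define u where "u = sgn x"
    define v where "v = sgn y"
    have u: "norm u = 1" "norm (x - a *\<^sub>R u) \<le> b - a"
    proof -
      have "x \<noteq> 0" using a x by auto
      then show "norm u = 1" by (simp add: u_def norm_sgn)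
      have "x - a *\<^sub>R u = (norm x - a) *\<^sub>R u"
        using \<open>x \<noteq> 0\<close> by (simp add: u_def sgn_div_norm algebra_simps)
      then show "norm (x - a *\<^sub>R u) \<le> b - a" using x \<open>norm u = 1\<close> by simp
    qed
    have v: "norm v = 1" "norm (y - a *\<^sub>R v) \<le> b - a"
    proof -
      have "y \<noteq> 0" using a y by auto
      then show "norm v = 1" by (simp add: v_def norm_sgn)
      have "y - a *\<^sub>R v = (norm y - a) *\<^sub>R v"
        using \<open>y \<noteq> 0\<close> by (simp add: v_def sgn_div_norm algebra_simps)
      then show "norm (y - a *\<^sub>R v) \<le> b - a" using y \<open>norm v = 1\<close> by simp
    qed
    have "norm (u - v) < e'"
    proof (rule ccontr)
      assume "\<not> norm (u - v) < e'"
      then have uv: "norm ((1/2) *\<^sub>R (u + v)) \<le> 1 - d" using dd u v by simp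
      have "(1/2) *\<^sub>R (x + y) = a *\<^sub>R ((1/2) *\<^sub>R (u + v)) + (1/2) *\<^sub>R ((x - a *\<^sub>R u) + (y - a *\<^sub>R v))"
        by (simp add: algebra_simps)
      then have "norm ((1/2) *\<^sub>R (x + y))
          \<le> norm (a *\<^sub>R ((1/2) *\<^sub>R (u + v))) + norm ((1/2) *\<^sub>R ((x - a *\<^sub>R u) + (y - a *\<^sub>R v)))"
        by (metis norm_triangle_ineq)
      also have "norm ((1/2) *\<^sub>R ((x - a *\<^sub>R u) + (y - a *\<^sub>R v))) \<le> b - a"
        using norm_triangle_ineq[of "x - a *\<^sub>R u" "y - a *\<^sub>R v"] u v by simp
      also have "norm (a *\<^sub>R ((1/2) *\<^sub>R (u + v))) \<le> a * (1 - d)"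
        using mult_left_mono[OF uv, of a] a by simp
      finally show False using mid ba by (simp add: algebra_simps)
    qed
    then have "norm (u - v) \<le> e" by (simp add: e'_def)
    have "x - y = a *\<^sub>R (u - v) + ((x - a *\<^sub>R u) - (y - a *\<^sub>R v))"
      by (simp add: algebra_simps)
    then have "norm (x - y) \<le> norm (a *\<^sub>R (u - v)) + norm ((x - a *\<^sub>R u) - (y - a *\<^sub>R v))"
      by (metis norm_triangle_ineq)
    also have "norm ((x - a *\<^sub>R u) - (y - a *\<^sub>R v)) \<le> 2 * (b - a)"
      using norm_triangle_ineq4[of "x - a *\<^sub>R u" "y - a *\<^sub>R v"] u v by simp
    also have "norm (a *\<^sub>R (u - v)) \<le> a * e"
      using \<open>norm (u - v) \<le> e\<close> a by simp
    finally show ?thesis by simp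
  qed
  then show ?thesis using d by blast
qed

text \<open>Strict convexity, obtained from a shell of thickness zero: with \<open>a = b = r\<close>
  the distance is at most \<open>r * e\<close> for every positive \<open>e\<close>.\<close>

lemma uniformly_convex_midpoint:
  assumes uc: "uniformly_convex_space TYPE('a::real_normed_vector)"
    and xy: "norm (x::'a) = r" "norm y = r" "r \<le> norm ((1/2) *\<^sub>R (x + y))"
  shows "x = y"
proof (cases "r = 0")
  case False
  then have r: "0 < r" using xy by (metis norm_ge_zero less_le)
  have "norm (x - y) \<le> r * e" if e: "0 < e" for e
  proof -
    obtain d where "0 < d" and "\<And>a b. \<And>x y::'a. 0 < a \<Longrightarrow> a \<le> norm x \<Longrightarrow> norm x \<le> b
      \<Longrightarrow> a \<le> norm y \<Longrightarrow> norm y \<le> b \<Longrightarrow> a \<le> norm ((1/2) *\<^sub>R (x + y)) \<Longrightarrow> b - a < a * d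
      \<Longrightarrow> norm (x - y) \<le> a * e + 2 * (b - a)"
      using uniformly_convex_near_norm[OF uc e] by blast
    from this(2)[of r x r y] show ?thesis using xy r \<open>0 < d\<close> by simp
  qed
  then have "norm (x - y) \<le> 0 + e" if "0 < e" for e
    using that r by (metis add_0 divide_pos_pos nonzero_mult_div_cancel_left times_divide_eq_right less_irrefl)
  then have "norm (x - y) \<le> 0" by (rule field_le_epsilon)
  then show ?thesis by simp
qed (use xy in auto)

text \<open>The midpoint of \<open>x\<close> and \<open>y\<close> stays in \<open>C\<close>, so its
  norm is bounded below by the distance of \<open>C\<close> from the origin and the shell estimate
  applies. The choice of \<open>d\<close> before \<open>C\<close> gives one estimate for many sets
  at once.\<close>

lemma uniformly_convex_near_infdist:
  assumes uc: "uniformly_convex_space TYPE('a::real_normed_vector)" and D: "0 \<le> D" and e: "0 < e"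
  shows "\<exists>d>0. \<forall>C. \<forall>x y::'a. convex C \<and> x \<in> C \<and> y \<in> C \<and> D - d \<le> infdist 0 C \<and>
    norm x \<le> D + d \<and> norm y \<le> D + d \<longrightarrow> norm (x - y) \<le> e"
\<comment> \<open>The shell estimate requires a positive inner radius, so \<open>D = 0\<close> is
  settled by the triangle inequality.\<close>
proof (cases "D = 0")
  case True
  have "norm (x - y) \<le> e" if "norm x \<le> e / 2" "norm y \<le> e / 2" for x y :: 'a
    using norm_triangle_ineq4[of x y] that by simp
  then show ?thesis using True e by (intro exI[of _ "e / 2"]) auto
next
  case False
  then have D: "0 < D" using D by simp
  then obtain d where d: "0 < d" and dd: "\<And>a b. \<And>x y::'a. 0 < a \<Longrightarrow> a \<le> norm x \<Longrightarrow> norm x \<le> b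
      \<Longrightarrow> a \<le> norm y \<Longrightarrow> norm y \<le> b \<Longrightarrow> a \<le> norm ((1/2) *\<^sub>R (x + y)) \<Longrightarrow> b - a < a * d
      \<Longrightarrow> norm (x - y) \<le> a * (e / (2 * D)) + 2 * (b - a)"
    using uniformly_convex_near_norm[OF uc, of "e / (2 * D)"] e by auto
  \<comment> \<open>The first bound keeps the inner radius \<open>D - h\<close> at least
    \<open>D / 2\<close>, the second makes the shell thin enough for \<open>d\<close>, and the third
    makes the error term \<open>4 * h\<close> at most \<open>e / 2\<close>.\<close>
  define h where "h = min (D / 2) (min (D * d / 8) (e / 8))"
  have h: "0 < h" "h \<le> D / 2" "h \<le> D * d / 8" "h \<le> e / 8"
    using D d e by (auto simp: h_def)
  have "norm (x - y) \<le> e"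
    if C: "convex C" "x \<in> C" "y \<in> C" and hC: "D - h \<le> infdist 0 C"
      and xy: "norm x \<le> D + h" "norm y \<le> D + h" for C and x y :: 'a
  proof -
    have low: "D - h \<le> norm z" if "z \<in> C" for z
      using infdist_le[OF that, of 0] hC by simp
    have "(1/2) *\<^sub>R (x + y) \<in> C"
      using convexD[OF C(1-3), of "1/2" "1/2"] by (simp add: scaleR_add_right)
    moreover have "(D + h) - (D - h) < (D - h) * d"
    proof -
      have "(D / 2) * d \<le> (D - h) * d" using h d by (intro mult_right_mono) auto
      moreover have "0 < D * d" using D d by simp
      ultimately show ?thesis using h by simp
    qed
    ultimately have "norm (x - y) \<le> (D - h) * (e / (2 * D)) + 2 * ((D + h) - (D - h))"
      using low[of x] low[of y] low[of "(1/2) *\<^sub>R (x + y)"] C xy h D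
      by (intro dd[of "D - h" x "D + h" y]) simp_all
    also have "(D - h) * (e / (2 * D)) \<le> D * (e / (2 * D))"
      using h D e by (intro mult_right_mono) auto
    also have "\<dots> = e / 2" using D by simp
    finally show ?thesis using h by simp
  qed
  then show ?thesis using h(1) by blast
qed

text \<open>
  This replaces weak compactness: along the finite intersections, points of almost minimal
  norm form a Cauchy family, and its limit lies in every member.
\<close>

lemma uniformly_convex_fip:
  fixes \<C> :: "'a::banach set set"
  assumes uc: "uniformly_convex_space TYPE('a)"
    and cl: "\<And>C. C \<in> \<C> \<Longrightarrow> closed C" and cv: "\<And>C. C \<in> \<C> \<Longrightarrow> convex C"
    and C0: "C0 \<in> \<C>" "bounded C0"
    and fip: "\<And>F. finite F \<Longrightarrow> F \<subseteq> \<C> \<Longrightarrow> \<Inter>F \<noteq> {}"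
  shows "\<Inter>\<C> \<noteq> {}"
proof -
  define dst where "dst F = infdist (0::'a) (\<Inter>F)" for F
  define \<F> where "\<F> = {F. finite F \<and> F \<subseteq> \<C>}"
  have mono: "dst F \<le> dst G" if "F \<subseteq> G" "G \<in> \<F>" for F G
    using that fip[of G] unfolding dst_def \<F>_def by (intro infdist_mono) auto
  have cvF: "convex (\<Inter>F)" if "F \<in> \<F>" for F
    using that cv by (intro convex_Inter) (auto simp: \<F>_def)
  obtain B where B: "\<And>x. x \<in> C0 \<Longrightarrow> norm x \<le> B"
    using C0 by (auto simp: bounded_iff)
  have "dst F \<le> B" if "F \<in> \<F>" for F
  proof -
    have ins: "insert C0 F \<in> \<F>" using that C0 by (auto simp: \<F>_def)
    then obtain z where z: "z \<in> \<Inter>(insert C0 F)" using fip[of "insert C0 F"] by (auto simp: \<F>_def)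
    then have "dst F \<le> norm z" using infdist_le[of z "\<Inter>F" 0] by (auto simp: dst_def)
    then show ?thesis using B z by force
  qed
  then have bdd: "bdd_above (dst ` \<F>)" by (auto simp: bdd_above_def)
  define D where "D = (SUP F\<in>\<F>. dst F)"
  \<comment> \<open>The empty family makes the supremum \<open>D\<close> range over a nonempty set
    and yields \<open>0 \<le> D\<close>.\<close>
  have "{} \<in> \<F>" by (simp add: \<F>_def)
  have dD: "dst F \<le> D" if "F \<in> \<F>" for F
    unfolding D_def using bdd that by (rule cSUP_upper2) simp
  have "0 \<le> D" using dD[OF \<open>{} \<in> \<F>\<close>] infdist_nonneg[of 0 "\<Inter>{}"] by (simp add: dst_def)
  have "\<exists>F\<in>\<F>. D - 1 / (Suc n) < dst F" for n
    unfolding D_def using less_cSUP_iff[of \<F> dst] bdd \<open>{} \<in> \<F>\<close>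
    by (metis D_def diff_less_eq empty_iff less_add_same_cancel1 of_nat_0_less_iff zero_less_Suc zero_less_divide_1_iff)
  then obtain P where P: "\<And>n. P n \<in> \<F>" "\<And>n. D - 1 / (Suc n) < dst (P n)" by metis
  \<comment> \<open>Accumulating the families \<open>P n\<close> makes the intersections decrease
    while their distances from the origin still tend to \<open>D\<close>.\<close>
  define G where "G n = \<Union>(P ` {..n})" for n
  have G: "G n \<in> \<F>" for n using P(1) by (fastforce simp: G_def \<F>_def)
  have Gd: "D - 1 / (Suc n) < dst (G n)" for n
    using P(2)[of n] mono[OF _ G, of "P n" n] by (force simp: G_def)
  have Gmono: "G m \<subseteq> G n" if "m \<le> n" for m n using that by (fastforce simp: G_def)
  have ex: "\<exists>x\<in>\<Inter>F. norm x < D + 1 / (Suc n)" if "F \<in> \<F>" for F n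
  proof -
    have "\<Inter>F \<noteq> {}" using fip that by (auto simp: \<F>_def)
    moreover have "infdist 0 (\<Inter>F) < D + 1 / (Suc n)"
      using dD[OF that] by (simp add: dst_def add_strict_increasing2 le_less_trans)
    ultimately show ?thesis
      using cInf_lessD[of "(\<lambda>a. dist 0 a) ` \<Inter>F"] by (auto simp: infdist_def)
  qed
  define S where "S n = {y \<in> \<Inter>(G n). norm y < D + 1 / (Suc n)}" for n
  have "\<forall>n. \<exists>x. x \<in> \<Inter>(G n) \<and> norm x < D + 1 / (Suc n)"
    using ex[OF G] by blast
  then obtain x where x: "\<And>n. x n \<in> S n"
    using choice[of "\<lambda>n x. x \<in> \<Inter>(G n) \<and> norm x < D + 1 / (Suc n)"] by (auto simp: S_def)
  \<comment> \<open>The estimate covers all points of the sets \<open>S n\<close>, not only the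
    chosen sequence \<open>x\<close>, because a second sequence is compared with \<open>x\<close>
    below.\<close>
  have close: "\<exists>N. \<forall>m\<ge>N. \<forall>n\<ge>N. \<forall>y\<in>S m. \<forall>z\<in>S n. norm (y - z) \<le> e" if e: "0 < e" for e
  proof -
    obtain d where d: "0 < d" and dd: "\<And>C. \<And>x y::'a. convex C \<Longrightarrow> x \<in> C \<Longrightarrow> y \<in> C \<Longrightarrow>
        D - d \<le> infdist 0 C \<Longrightarrow> norm x \<le> D + d \<Longrightarrow> norm y \<le> D + d \<Longrightarrow> norm (x - y) \<le> e"
      using uniformly_convex_near_infdist[OF uc \<open>0 \<le> D\<close> e] by blast
    obtain N where N: "1 / (Suc N) < d"
      using d by (rule nat_approx_posE)
    have small: "1 / real (Suc n) \<le> d" if "N \<le> n" for n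
    proof -
      have "1 / real (Suc n) \<le> 1 / real (Suc N)" using that by (intro divide_left_mono) auto
      then show ?thesis using N by linarith
    qed
    have "norm (y - z) \<le> e" if "N \<le> m" "N \<le> n" "y \<in> S m" "z \<in> S n" for m n y z
    proof (rule dd[OF cvF[OF G[of N]]])
      show "y \<in> \<Inter>(G N)" "z \<in> \<Inter>(G N)" using that Gmono unfolding S_def by blast+
      show "D - d \<le> infdist 0 (\<Inter>(G N))" using Gd[of N] N by (simp add: dst_def)
      have "norm y < D + 1 / (Suc m)" "norm z < D + 1 / (Suc n)" using that by (auto simp: S_def)
      then show "norm y \<le> D + d" "norm z \<le> D + d" using small[of m] small[of n] that by linarith+
    qed
    then show ?thesis by blast
  qed
  have "Cauchy x"
  proof (rule metric_CauchyI)
    fix e :: real assume e: "0 < e"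
    obtain N where N: "\<forall>m\<ge>N. \<forall>n\<ge>N. \<forall>y\<in>S m. \<forall>z\<in>S n. norm (y - z) \<le> e / 2"
      using close[OF half_gt_zero[OF e]] by blast
    have "dist (x m) (x n) < e" if "N \<le> m" "N \<le> n" for m n
      using N[rule_format, OF that x x] e by (simp add: dist_norm)
    then show "\<exists>M. \<forall>m\<ge>M. \<forall>n\<ge>M. dist (x m) (x n) < e" by blast
  qed
  then obtain l where l: "x \<longlonglongrightarrow> l" using Cauchy_convergent convergent_def by blast
  have "l \<in> C" if "C \<in> \<C>" for C
  proof -
    \<comment> \<open>Distances of finite intersections never exceed \<open>D\<close>, so adjoining
      \<open>C\<close> still leaves a point of \<open>S n\<close> inside \<open>C\<close>. These
      points have the same limit \<open>l\<close>, and \<open>C\<close> is closed.\<close>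
    have "insert C (G n) \<in> \<F>" for n using G[of n] that by (auto simp: \<F>_def)
    then have "\<exists>y\<in>\<Inter>(insert C (G n)). norm y < D + 1 / (Suc n)" for n using ex by blast
    then have "\<forall>n. \<exists>y. y \<in> C \<and> y \<in> S n" unfolding S_def by (simp add: Bex_def)
    then obtain y where y: "\<And>n. y n \<in> C" "\<And>n. y n \<in> S n"
      using choice[of "\<lambda>n y. y \<in> C \<and> y \<in> S n"] by blast
    have "(\<lambda>n. y n - x n) \<longlonglongrightarrow> 0"
    proof (rule LIMSEQ_I)
      fix e :: real assume e: "0 < e"
      obtain N where N: "\<forall>m\<ge>N. \<forall>n\<ge>N. \<forall>y\<in>S m. \<forall>z\<in>S n. norm (y - z) \<le> e / 2"
        using close[OF half_gt_zero[OF e]] by blast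
      have "norm (y n - x n - 0) < e" if "N \<le> n" for n
        using N[rule_format, OF that that y(2) x] e by simp
      then show "\<exists>N. \<forall>n\<ge>N. norm (y n - x n - 0) < e" by blast
    qed
    from tendsto_add[OF this l] have "y \<longlonglongrightarrow> l" by simp
    then show ?thesis
      using closed_sequentially[OF cl[OF that]] y(1) by blast
  qed
  then show ?thesis by blast
qed

section \<open>Smoothness and the derivative of the norm\<close>

lemma scale_into_cball:
  assumes "0 < d"
  shows "\<exists>c>0. c * norm w \<le> d"
proof (intro exI conjI)
  have n: "0 < norm w + 1" by (simp add: add_nonneg_pos)
  then show "0 < d / (norm w + 1)" using assms by simp
  show "d / (norm w + 1) * norm w \<le> d" using assms n by (simp add: divide_le_eq algebra_simps)
qed

text \<open>The definition concerns unit vectors; homogeneity carries it to \<open>x\<close> after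
  dividing by \<open>norm x\<close>. The factor 1/2 in the definition explains the use of
  \<open>e / 2\<close>.\<close>

lemma uniformly_smooth_at:
  assumes us: "uniformly_smooth_space TYPE('a::real_normed_vector)" and x: "(x::'a) \<noteq> 0" and e: "0 < e"
  shows "\<exists>d>0. \<forall>v. norm v \<le> d \<longrightarrow> norm (x + v) + norm (x - v) - 2 * norm x \<le> e * norm v"
proof -
  have "0 < e / 2" using e by simp
  with us obtain d where d: "0 < d" and dd: "\<forall>x y::'a. norm x = 1 \<and> norm y \<le> d \<longrightarrow>
      (norm (x + y) + norm (x - y)) / 2 - 1 \<le> e / 2 * norm y"
    unfolding uniformly_smooth_space_def by (auto simp only:)
  have "norm (x + v) + norm (x - v) - 2 * norm x \<le> e * norm v" if v: "norm v \<le> norm x * d" for v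
  proof -
    define c where "c = inverse (norm x)"
    have c: "0 < c" "c * norm x = 1" using x by (auto simp: c_def)
    have "norm (c *\<^sub>R v) = c * norm v" using c by simp
    also have "\<dots> \<le> d" using mult_left_mono[OF v, of c] c by (simp add: mult.assoc[symmetric])
    finally have "(norm (c *\<^sub>R x + c *\<^sub>R v) + norm (c *\<^sub>R x - c *\<^sub>R v)) / 2 - 1 \<le> e / 2 * norm (c *\<^sub>R v)"
      using dd[rule_format, of "c *\<^sub>R x" "c *\<^sub>R v"] c by simp
    then have "c * (norm (x + v) + norm (x - v) - 2 * norm x) \<le> c * (e * norm v)"
    proof -
      have "norm (c *\<^sub>R x + c *\<^sub>R v) = c * norm (x + v)" "norm (c *\<^sub>R x - c *\<^sub>R v) = c * norm (x - v)"
        using norm_scaleR[of c "x + v"] norm_scaleR[of c "x - v"] c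
        by (simp_all add: scaleR_add_right scaleR_diff_right)
      moreover have "norm (c *\<^sub>R v) = c * norm v" using c by simp
      moreover note c(2)
      ultimately show ?thesis
        using \<open>_ \<le> e / 2 * norm (c *\<^sub>R v)\<close> by (simp only: distrib_left right_diff_distrib) argo
    qed
    then show ?thesis using c by simp
  qed
  moreover have "0 < norm x * d" using x d by simp
  ultimately show ?thesis by blast
qed

text \<open>Convexity makes the difference quotients monotone in \<open>s\<close>, so their limit at
  0 exists as an infimum and is sublinear in the direction. Smoothness makes it odd, and a sublinear
  odd function is linear.\<close>

lemma norm_right_derivative:
  assumes us: "uniformly_smooth_space TYPE('a::real_normed_vector)" and x: "(x::'a) \<noteq> 0"
  shows "\<exists>D :: 'a \<Rightarrow>\<^sub>L real. norm D = 1 \<and> blinfun_apply D x = norm x \<and>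
    (\<forall>v. ((\<lambda>s. norm (x + s *\<^sub>R v)) has_real_derivative blinfun_apply D v) (at_right 0))"
proof -
  define q where "q v s = (norm (x + s *\<^sub>R v) - norm x) / s" for v and s :: real
  have abs_q: "\<bar>q v s\<bar> \<le> norm v" if "0 < s" for v s
  proof -
    have "\<bar>norm (x + s *\<^sub>R v) - norm x\<bar> \<le> s * norm v"
      using norm_triangle_ineq3[of "x + s *\<^sub>R v" x] that by simp
    then show ?thesis using that by (simp add: q_def divide_le_eq mult.commute)
  qed
  have q_mono: "q v s \<le> q v r" if "0 < s" "s \<le> r" for v s r
  proof -
    define u where "u = s / r"
    have u: "0 < u" "u \<le> 1" "s = u * r" using that by (auto simp: u_def)
    have "x + s *\<^sub>R v = (1 - u) *\<^sub>R x + u *\<^sub>R (x + r *\<^sub>R v)"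
      by (simp add: u algebra_simps)
    then have "norm (x + s *\<^sub>R v) \<le> (1 - u) * norm x + u * norm (x + r *\<^sub>R v)"
      using norm_triangle_ineq[of "(1 - u) *\<^sub>R x" "u *\<^sub>R (x + r *\<^sub>R v)"] u by simp
    then have "norm (x + s *\<^sub>R v) - norm x \<le> u * (norm (x + r *\<^sub>R v) - norm x)"
      by (simp add: algebra_simps)
    then have "(norm (x + s *\<^sub>R v) - norm x) / s \<le> u * (norm (x + r *\<^sub>R v) - norm x) / s"
      using that by (intro divide_right_mono) auto
    then show ?thesis using u that by (simp add: q_def)
  qed
  define D where "D v = Inf (q v ` {0<..})" for v
  have bdd: "bdd_below (q v ` {0<..})" for v
    using abs_q[of _ v] by (intro bdd_belowI2[of _ "- norm v"]) (force simp: abs_le_iff)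
  have D_le: "D v \<le> q v s" if "0 < s" for v s
    unfolding D_def using bdd that by (intro cInf_lower) auto
  have q_lim: "(q v \<longlongrightarrow> D v) (at_right 0)" for v
  proof (rule order_tendstoI)
    fix a assume "a < D v"
    then show "\<forall>\<^sub>F s in at_right 0. a < q v s"
      using D_le by (intro eventually_at_rightI[of 0 1]) (auto intro: less_le_trans)
  next
    fix a assume "D v < a"
    then obtain r where r: "0 < r" "q v r < a"
      unfolding D_def using cInf_lessD[of "q v ` {0<..}" a] by auto
    then show "\<forall>\<^sub>F s in at_right 0. q v s < a"
      using q_mono[of _ r v] by (intro eventually_at_rightI[of 0 r]) (auto intro: le_less_trans[OF _ r(2)])
  qed
  have at0: "\<forall>\<^sub>F s in at_right 0. 0 < (s::real)" by (rule eventually_at_right_less)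
  have D_scale: "D (c *\<^sub>R v) = c * D v" if c: "0 < c" for c v
  proof (rule tendsto_unique)
    show "(q (c *\<^sub>R v) \<longlongrightarrow> D (c *\<^sub>R v)) (at_right 0)" by (rule q_lim)
    have "filterlim (\<lambda>s. c * s) (at_right 0) (at_right 0)"
      using c filterlim_times_pos[of "\<lambda>s. s" 0 "at_right 0" c] by (simp add: filterlim_ident)
    then have "((\<lambda>s. c * q v (c * s)) \<longlongrightarrow> c * D v) (at_right 0)"
      by (intro tendsto_intros filterlim_compose[OF q_lim])
    then show "(q (c *\<^sub>R v) \<longlongrightarrow> c * D v) (at_right 0)"
      by (rule Lim_transform_eventually)
        (use at0 in eventually_elim, use c in \<open>simp add: q_def mult.commute\<close>)
  qed simp
  have D_zero: "D 0 = 0"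
    by (rule tendsto_unique[OF _ q_lim]) (simp_all add: q_def[abs_def])
  have D_subadd: "D (u + v) \<le> D u + D v" for u v
  proof -
    \<comment> \<open>The point \<open>x + s *\<^sub>R (u + v)\<close> is the midpoint of the points
      reached in the directions \<open>2 *\<^sub>R u\<close> and
      \<open>2 *\<^sub>R v\<close>.\<close>
    have "q (u + v) s \<le> q (2 *\<^sub>R u) s / 2 + q (2 *\<^sub>R v) s / 2" if "0 < s" for s
    proof -
      have "2 *\<^sub>R (x + s *\<^sub>R (u + v)) = (x + s *\<^sub>R (2 *\<^sub>R u)) + (x + s *\<^sub>R (2 *\<^sub>R v))"
        by (simp only: scaleR_2 scaleR_add_right ac_simps)
      then have "2 * norm (x + s *\<^sub>R (u + v)) \<le> norm (x + s *\<^sub>R (2 *\<^sub>R u)) + norm (x + s *\<^sub>R (2 *\<^sub>R v))"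
        by (metis norm_triangle_ineq norm_scaleR abs_numeral)
      then have "(norm (x + s *\<^sub>R (u + v)) - norm x) / s
          \<le> (norm (x + s *\<^sub>R (2 *\<^sub>R u)) / 2 + norm (x + s *\<^sub>R (2 *\<^sub>R v)) / 2 - norm x) / s"
        using that by (intro divide_right_mono) auto
      then show ?thesis by (simp add: q_def diff_divide_distrib add_divide_distrib)
    qed
    then have "\<forall>\<^sub>F s in at_right 0. q (u + v) s \<le> q (2 *\<^sub>R u) s / 2 + q (2 *\<^sub>R v) s / 2"
      by (intro eventually_at_rightI[of 0 1]) auto
    moreover have "((\<lambda>s. q (2 *\<^sub>R u) s / 2 + q (2 *\<^sub>R v) s / 2) \<longlongrightarrow>
        D (2 *\<^sub>R u) / 2 + D (2 *\<^sub>R v) / 2) (at_right 0)"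
      by (intro tendsto_intros q_lim) simp_all
    ultimately have "D (u + v) \<le> D (2 *\<^sub>R u) / 2 + D (2 *\<^sub>R v) / 2"
      using q_lim by (intro tendsto_le[of "at_right 0"]) auto
    then show ?thesis using D_scale[of 2] by simp
  qed
  have D_minus: "D (- v) = - D v" for v
  proof (rule antisym)
    show "- D v \<le> D (- v)" using D_subadd[of v "- v"] D_zero by simp
    \<comment> \<open>The sum of the quotients in directions \<open>v\<close> and \<open>- v\<close>
      is a symmetric second difference of the norm divided by \<open>s\<close>, which smoothness
      controls.\<close>
    have small: "D v + D (- v) \<le> e * norm v" if e: "0 < e" for e
    proof -
      obtain d where d: "0 < d" and dd: "\<And>w. norm w \<le> d \<Longrightarrow>
          norm (x + w) + norm (x - w) - 2 * norm x \<le> e * norm w"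
        using uniformly_smooth_at[OF us x e] by blast
      obtain s where s: "0 < s" "s * norm v \<le> d" using scale_into_cball[OF d] by blast
      then have "norm (x + s *\<^sub>R v) + norm (x - s *\<^sub>R v) - 2 * norm x \<le> e * (s * norm v)"
        using dd[of "s *\<^sub>R v"] s by simp
      then have "(norm (x + s *\<^sub>R v) + norm (x - s *\<^sub>R v) - 2 * norm x) / s \<le> e * norm v"
        using s by (simp add: divide_le_eq mult_ac)
      then have "q v s + q (- v) s \<le> e * norm v"
        by (simp add: q_def add_divide_distrib diff_divide_distrib)
      then show ?thesis using D_le[OF s(1), of v] D_le[OF s(1), of "- v"] by linarith
    qed
    have "D v + D (- v) \<le> 0 + e" if e: "0 < e" for e
    proof -
      obtain c where "0 < c" "c * norm v \<le> e" using scale_into_cball[OF e] by blast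
      with small[of c] show ?thesis by simp
    qed
    then have "D v + D (- v) \<le> 0" by (rule field_le_epsilon)
    then show "D (- v) \<le> - D v" by simp
  qed
  have D_add: "D (u + v) = D u + D v" for u v
    using D_subadd[of u v] D_subadd[of "u + v" "- v"] D_minus[of v] by simp
  have D_scaleR: "D (c *\<^sub>R v) = c *\<^sub>R D v" for c v
  proof (cases c "0::real" rule: linorder_cases)
    case less
    then show ?thesis using D_scale[of "- c" v] D_minus[of "c *\<^sub>R v"] by simp
  qed (use D_scale D_zero in auto)
  have D_abs: "\<bar>D v\<bar> \<le> norm v" for v
  proof -
    have "D v \<le> norm v" for v using D_le[of 1 v] abs_q[of 1 v] by simp
    from this[of v] this[of "- v"] show ?thesis by (simp add: D_minus abs_le_iff)
  qed
  define E where "E = Blinfun D"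
  have "bounded_linear D"
    using D_add D_scaleR D_abs by (intro bounded_linear_intro[where K = 1]) auto
  then have E: "blinfun_apply E = D" by (simp add: E_def bounded_linear_Blinfun_apply)
  have Dx: "D x = norm x"
  proof (rule tendsto_unique[OF _ q_lim])
    have "q x s = norm x" if "0 < s" for s
    proof -
      have "x + s *\<^sub>R x = (1 + s) *\<^sub>R x" by (simp add: scaleR_add_left)
      then have "norm (x + s *\<^sub>R x) = (1 + s) * norm x" using that by simp
      then show ?thesis using that by (simp add: q_def distrib_right)
    qed
    then show "(q x \<longlongrightarrow> norm x) (at_right 0)"
      by (intro tendsto_eventually eventually_at_rightI[of 0 1]) auto
  qed simp
  have "norm E \<le> 1" using D_abs by (intro norm_blinfun_bound) (auto simp: E)
  moreover have "1 \<le> norm E"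
    using norm_blinfun[of E x] x by (simp add: E Dx)
  moreover have "((\<lambda>s. norm (x + s *\<^sub>R v)) has_real_derivative D v) (at_right 0)" for v
    using q_lim[of v] by (simp add: has_field_derivative_iff q_def[abs_def])
  ultimately show ?thesis using E Dx by (intro exI[of _ E]) auto
qed

section \<open>The duality mapping\<close>

text \<open>Away from 0 this is the chain rule: the derivative of the norm has dual norm 1, and the
  factor \<open>norm x powr (p - 1)\<close> turns it into an element of
  \<open>duality_map p x\<close>.\<close>

lemma duality_map_right_derivative:
  assumes us: "uniformly_smooth_space TYPE('a::real_normed_vector)" and p: "1 < p"
  shows "\<exists>j \<in> duality_map p (x::'a). \<forall>v.
    ((\<lambda>s. norm (x + s *\<^sub>R v) powr p / p) has_real_derivative blinfun_apply j v) (at_right 0)"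
proof (cases "x = 0")
  case True
  \<comment> \<open>The norm is not differentiable at 0 in general, but the quotient is a multiple
    of \<open>s powr (p - 1)\<close>, which vanishes in the limit since
    \<open>p > 1\<close>.\<close>
  have "((\<lambda>s. norm (s *\<^sub>R v) powr p / p) has_real_derivative 0) (at_right 0)" for v :: 'a
  proof -
    have "((\<lambda>s::real. s powr (p - 1)) \<longlongrightarrow> 0 powr (p - 1)) (at_right 0)"
      using p by (intro tendsto_powr2 tendsto_intros) (auto intro: eventually_at_rightI[of 0 1])
    then have "((\<lambda>s. s powr (p - 1) * (norm v powr p / p)) \<longlongrightarrow> 0) (at_right 0)"
      by (intro tendsto_mult_left_zero) simp
    then have "((\<lambda>s. norm (s *\<^sub>R v) powr p / p / s) \<longlongrightarrow> 0) (at_right 0)"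
      by (rule Lim_transform_eventually)
        (auto simp: powr_mult powr_diff intro!: eventually_at_rightI[of 0 1])
    then show ?thesis by (simp add: has_field_derivative_iff)
  qed
  then show ?thesis using True by (intro bexI[of _ 0]) (auto simp: duality_map_def)
next
  case False
  obtain D :: "'a \<Rightarrow>\<^sub>L real" where D: "norm D = 1" "blinfun_apply D x = norm x"
    and der: "\<And>v. ((\<lambda>s. norm (x + s *\<^sub>R v)) has_real_derivative blinfun_apply D v) (at_right 0)"
    using norm_right_derivative[OF us False] by blast
  define j where "j = (norm x powr (p - 1)) *\<^sub>R D"
  have "j \<in> duality_map p x" using D by (simp add: duality_map_def j_def blinfun.scaleR_left)
  moreover have "((\<lambda>s. norm (x + s *\<^sub>R v) powr p / p) has_real_derivative blinfun_apply j v) (at_right 0)" for v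
    using False p by (auto intro!: derivative_eq_intros der simp: j_def blinfun.scaleR_left)
  ultimately show ?thesis by blast
qed

text \<open>Both functionals have norm \<open>r\<close> and attain it at \<open>x\<close>. Adding
  their bounds at \<open>x + w\<close> and \<open>x - w\<close> estimates \<open>(f - g) w\<close>
  by \<open>r\<close> times a symmetric second difference of the norm, which is o(norm w) by
  smoothness; linearity then forces \<open>f - g\<close> to vanish.\<close>

lemma duality_map_unique:
  assumes us: "uniformly_smooth_space TYPE('a::real_normed_vector)"
    and fg: "f \<in> duality_map p (x::'a)" "g \<in> duality_map p x"
  shows "f = g"
proof (cases "x = 0")
  case True
  then show ?thesis using fg by (simp add: duality_map_def)
next
  case x: False
  define r where "r = norm x powr (p - 1)"
  have r: "norm f = r" "norm g = r" "f x = norm x * r" "g x = norm x * r"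
    using fg by (auto simp: duality_map_def r_def)
  have "0 < r" using x by (simp add: r_def)
  have le: "norm (f - g) \<le> r * e" if e: "0 < e" for e
  proof -
    obtain d where d: "0 < d" and dd: "\<And>w. norm w \<le> d \<Longrightarrow>
        norm (x + w) + norm (x - w) - 2 * norm x \<le> e * norm w"
      using uniformly_smooth_at[OF us x e] by blast
    have small: "(f - g) w \<le> r * e * norm w" if "norm w \<le> d" for w
    proof -
      have "f (x + w) \<le> r * norm (x + w)" "g (x - w) \<le> r * norm (x - w)"
        using norm_blinfun[of f "x + w"] norm_blinfun[of g "x - w"] r by auto
      then have "(f - g) w \<le> r * (norm (x + w) + norm (x - w) - 2 * norm x)"
        using r by (simp add: blinfun.add_right blinfun.diff_right blinfun.diff_left algebra_simps)
      also have "\<dots> \<le> r * (e * norm w)"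
        using dd[OF that] \<open>0 < r\<close> by (intro mult_left_mono) auto
      finally show ?thesis by simp
    qed
    have "(f - g) w \<le> r * e * norm w" for w
    proof -
      obtain c where c: "0 < c" "c * norm w \<le> d" using scale_into_cball[OF d] by blast
      then have "c * (f - g) w \<le> c * (r * e * norm w)"
        using small[of "c *\<^sub>R w"] c by (simp add: blinfun.scaleR_right algebra_simps)
      then show ?thesis using c by simp
    qed
    from this[of w for w] this[of "- w" for w] have "\<bar>(f - g) w\<bar> \<le> r * e * norm w" for w
      by (simp add: abs_le_iff blinfun.minus_right)
    then show ?thesis using \<open>0 < r\<close> e by (intro norm_blinfun_bound) auto
  qed
  have "norm (f - g) \<le> 0 + e" if "0 < e" for e
    using le[of "e / r"] that \<open>0 < r\<close> by simp
  then have "norm (f - g) \<le> 0" by (rule field_le_epsilon)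
  then show ?thesis by simp
qed

text \<open>The pairing dominates \<open>(norm x - norm z) * (r x - r z)\<close>, whose factors have
  the same sign, so the norms agree. Then \<open>f\<close> attains its norm at both points, which
  makes \<open>norm (x + z)\<close> at least \<open>2 * norm x\<close>, and strict convexity
  applies.\<close>

lemma duality_map_strictly_monotone:
  assumes uc: "uniformly_convex_space TYPE('a::real_normed_vector)" and p: "1 < p"
    and f: "f \<in> duality_map p (x::'a)" and g: "g \<in> duality_map p z"
    and le: "blinfun_apply (f - g) (x - z) \<le> 0"
  shows "x = z"
proof -
  define r where "r w = norm w powr (p - 1)" for w :: 'a
  have fx: "norm f = r x" "f x = norm x * r x" using f by (auto simp: duality_map_def r_def)
  have gz: "norm g = r z" "g z = norm z * r z" using g by (auto simp: duality_map_def r_def)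
  have fz: "f z \<le> r x * norm z" using norm_blinfun[of f z] fx by simp
  have gx: "g x \<le> r z * norm x" using norm_blinfun[of g x] gz by simp
  have sum: "norm x * r x + norm z * r z \<le> f z + g x"
    using le by (simp add: blinfun.diff_left blinfun.diff_right fx gz)
  then have prod: "(norm x - norm z) * (r x - r z) \<le> 0" using fz gx by (simp add: algebra_simps)
  have r_less: "r u < r w" if "norm u < norm w" for u w
    using that p unfolding r_def by (intro powr_less_mono2) auto
  have eq: "norm x = norm z"
  proof (cases "norm x" "norm z" rule: linorder_cases)
    case less
    with r_less[of x z] prod show ?thesis by (simp add: mult_le_0_iff)
  next
    case greater
    with r_less[of z x] prod show ?thesis by (simp add: mult_le_0_iff)
  qed
  then have "r x = r z" by (simp add: r_def)
  show ?thesis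
  proof (cases "x = 0")
    case False
    then have "0 < r x" by (simp add: r_def)
    have "norm x * r x \<le> f z" using sum gx eq \<open>r x = r z\<close> by (simp add: algebra_simps)
    then have "2 * norm x * r x \<le> f (x + z)" by (simp add: blinfun.add_right fx)
    also have "\<dots> \<le> r x * norm (x + z)" using norm_blinfun[of f "x + z"] fx by simp
    finally have "2 * norm x \<le> norm (x + z)" using \<open>0 < r x\<close> by (simp add: mult.commute)
    then show ?thesis using uniformly_convex_midpoint[OF uc refl eq[symmetric]] by simp
  qed (use eq in simp)
qed

section \<open>The variational inequality\<close>

text \<open>
  Stating the inequality with \<open>\<parallel>x\<parallel>\<^sup>p/p\<close> instead of its gradient makes the solution set of each
  member of the graph convex and closed.
\<close>

lemma monotone_variational_inequality:
  fixes Gr :: "('a::banach \<times> ('a \<Rightarrow>\<^sub>L real)) set"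
  assumes uc: "uniformly_convex_space TYPE('a)" and p: "1 < p"
    and b0: "(0, b0) \<in> Gr"
    and mono: "\<And>y b z c. (y, b) \<in> Gr \<Longrightarrow> (z, c) \<in> Gr \<Longrightarrow> 0 \<le> blinfun_apply (b - c) (y - z)"
  shows "\<exists>x. \<forall>y b. (y, b) \<in> Gr \<longrightarrow>
    blinfun_apply b x + norm x powr p / p \<le> blinfun_apply b y + norm y powr p / p"
proof -
  define \<psi> where "\<psi> b x = blinfun_apply b x + norm x powr p / p" for b and x :: 'a
  define K where "K = (\<lambda>(y, b). {x. \<psi> b x \<le> \<psi> b y})"
  have conv: "convex_on UNIV (\<psi> b)" for b
  proof -
    have "convex_on UNIV (\<lambda>x::'a. 1 / p * norm x powr p)"
      using p by (intro convex_on_cmul norm_powr_convex) auto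
    moreover have "convex_on UNIV (blinfun_apply b)"
      by (auto intro!: convex_onI simp: blinfun.add_right blinfun.scaleR_right)
    ultimately show ?thesis unfolding \<psi>_def[abs_def] by (auto dest: convex_on_add)
  qed
  have "\<Inter>(K ` Gr) \<noteq> {}"
  proof (rule uniformly_convex_fip[OF uc])
    show "closed C" if "C \<in> K ` Gr" for C
    proof -
      have "continuous_on UNIV (\<psi> b)" for b
        unfolding \<psi>_def[abs_def] using p by (intro continuous_intros continuous_on_powr') auto
      then show ?thesis using that by (auto simp: K_def intro!: closed_Collect_le continuous_intros)
    qed
    show "convex C" if "C \<in> K ` Gr" for C
    proof -
      from that obtain i where "C = K i" by blast
      moreover obtain y b where "i = (y, b)" by (cases i)
      ultimately have C: "C = {x. \<psi> b x \<le> \<psi> b y}" by (simp add: K_def)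
      have "\<psi> b (u *\<^sub>R x + v *\<^sub>R z) \<le> \<psi> b y"
        if "\<psi> b x \<le> \<psi> b y" "\<psi> b z \<le> \<psi> b y" "0 \<le> u" "0 \<le> v" "u + v = 1" for x z u v
      proof -
        have "\<psi> b (u *\<^sub>R x + v *\<^sub>R z) \<le> u * \<psi> b x + v * \<psi> b z"
          using conv[of b] that by (auto simp: convex_on_def)
        also have "\<dots> \<le> u * \<psi> b y + v * \<psi> b y"
          using that by (intro add_mono mult_left_mono) auto
        finally show ?thesis using that by (simp add: distrib_right[symmetric])
      qed
      then show ?thesis unfolding C convex_def by blast
    qed
    show "K (0, b0) \<in> K ` Gr" using b0 by blast
    \<comment> \<open>At \<open>y = 0\<close> the right-hand side \<open>\<psi> b0 0\<close> is 0,
      so \<open>norm x powr p / p\<close> is at most \<open>norm b0 * norm x\<close>; the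
      superlinear growth for \<open>p > 1\<close> bounds \<open>x\<close>.\<close>
    have "norm x \<le> (p * norm b0) powr (1 / (p - 1))" if "x \<in> K (0, b0)" for x
    proof (cases "x = 0")
      case False
      have "norm x powr p / p \<le> - b0 x"
        using that p by (simp add: K_def \<psi>_def)
      also have "\<dots> \<le> norm b0 * norm x" using norm_blinfun[of b0 x] by (simp add: abs_le_iff)
      finally have "norm x powr (p - 1) \<le> p * norm b0"
        using False p by (simp add: powr_diff field_simps)
      then have "(norm x powr (p - 1)) powr (1 / (p - 1)) \<le> (p * norm b0) powr (1 / (p - 1))"
        using p by (intro powr_mono2) auto
      then show ?thesis using p False by (simp add: powr_powr)
    qed simp
    then show "bounded (K (0, b0))" unfolding bounded_iff by blast
    show "\<Inter>F \<noteq> {}" if F: "finite F" "F \<subseteq> K ` Gr" for F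
    proof -
      obtain S where S: "S \<subseteq> Gr" "finite S" "F = K ` S" using finite_subset_image[OF F] by blast
      show ?thesis
      proof (cases "S = {}")
        case False
        \<comment> \<open>In \<open>M i j + M j i\<close> the norm terms cancel, leaving the pairing
          of the differences of functionals and points, which is nonnegative by
          monotonicity.\<close>
        define M where "M i j = \<psi> (snd i) (fst i) - \<psi> (snd i) (fst j)" for i j :: "'a \<times> ('a \<Rightarrow>\<^sub>L real)"
        have "0 \<le> M i j + M j i" if "i \<in> S" "j \<in> S" for i j
        proof -
          have "i \<in> Gr" "j \<in> Gr" using that S(1) by auto
          then show ?thesis
            using mono[of "fst i" "snd i" "fst j" "snd j"]
            by (simp add: M_def \<psi>_def blinfun.diff_left blinfun.diff_right)
        qed
        then obtain l where l: "\<And>i. i \<in> S \<Longrightarrow> 0 \<le> l i" "sum l S = 1"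
            "\<And>i. i \<in> S \<Longrightarrow> 0 \<le> (\<Sum>j\<in>S. M i j * l j)"
          using simplex_solution[OF S(2) False, of M] by blast
        \<comment> \<open>By Jensen's inequality for \<open>\<psi> (snd i)\<close>, nonnegativity of
          row \<open>i\<close> of \<open>M\<close> at \<open>l\<close> puts this convex combination
          into \<open>K i\<close>.\<close>
        define x where "x = (\<Sum>j\<in>S. l j *\<^sub>R fst j)"
        have "x \<in> K i" if i: "i \<in> S" for i
        proof -
          have "\<psi> (snd i) x \<le> (\<Sum>j\<in>S. l j * \<psi> (snd i) (fst j))"
            unfolding x_def using l S False by (intro convex_on_sum[OF _ _ conv]) auto
          also have "\<dots> = \<psi> (snd i) (fst i) * sum l S - (\<Sum>j\<in>S. M i j * l j)"
            by (simp add: M_def sum_distrib_left left_diff_distrib sum_subtractf) (simp add: mult.commute)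
          also have "\<dots> \<le> \<psi> (snd i) (fst i)" using l i by simp
          finally show ?thesis by (simp add: K_def case_prod_beta)
        qed
        then show ?thesis using S by blast
      qed (use S in simp)
    qed
  qed
  then show ?thesis by (fastforce simp: K_def \<psi>_def)
qed

section \<open>Maximal monotonicity and the range condition\<close>

theorem lemma3p3:
  fixes A :: "'a::banach \<Rightarrow> ('a \<Rightarrow>\<^sub>L real) set"
    and p t\<^sub>0 :: real
  assumes "uniformly_smooth_space TYPE('a)"
    and "uniformly_convex_space TYPE('a)"
    and "p > 1"
    and "mv_domain A = UNIV"
    and "gen_Phi_strongly_monotone A"
    and "t\<^sub>0 > 0"
    and "mv_range (mv_add (duality_map p) (mv_scale t\<^sub>0 A)) = UNIV"
  shows "range_condition p A"
proof -
  note us = assms(1) and uc = assms(2) and p = assms(3)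
  have ne: "A y \<noteq> {}" for y using assms(4) by (auto simp: mv_domain_def)
  have mono: "0 \<le> blinfun_apply (\<mu> - \<nu>) (x - y)" if "\<mu> \<in> A x" "\<nu> \<in> A y" for x y \<mu> \<nu>
  proof -
    obtain \<Phi> :: "real \<Rightarrow> real" where "\<Phi> ` {0..} \<subseteq> {0..}"
      and "\<forall>x \<in> mv_domain A. \<forall>y \<in> mv_domain A. \<forall>\<mu> \<in> A x. \<forall>\<nu> \<in> A y.
           blinfun_apply (\<mu> - \<nu>) (x - y) \<ge> \<Phi> (norm (x - y))"
      using assms(5) unfolding gen_Phi_strongly_monotone_def by blast
    then have "0 \<le> \<Phi> (norm (x - y))" "\<Phi> (norm (x - y)) \<le> blinfun_apply (\<mu> - \<nu>) (x - y)"
      using that assms(4) by (auto simp: image_subset_iff)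
    then show ?thesis by linarith
  qed
  \<comment> \<open>Surjectivity at \<open>t\<^sub>0\<close> writes
    \<open>j + t\<^sub>0 *\<^sub>R h\<close> as \<open>g + t\<^sub>0 *\<^sub>R \<nu>\<close> with
    \<open>\<nu> \<in> A z\<close>. The relation to the graph makes the pairing of
    \<open>j - g\<close> with \<open>x - z\<close> nonpositive, so \<open>x = z\<close>, then
    \<open>g = j\<close>, and finally \<open>h = \<nu>\<close>.\<close>
  have maximal: "h \<in> A x"
    if related: "\<And>y \<nu>. \<nu> \<in> A y \<Longrightarrow> 0 \<le> blinfun_apply (\<nu> - h) (y - x)"
      and j: "j \<in> duality_map p x" for x h j
  proof -
    have "j + t\<^sub>0 *\<^sub>R h \<in> mv_range (mv_add (duality_map p) (mv_scale t\<^sub>0 A))"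
      using assms(7) by simp
    then obtain z g \<nu> where z: "g \<in> duality_map p z" "\<nu> \<in> A z" "j + t\<^sub>0 *\<^sub>R h = g + t\<^sub>0 *\<^sub>R \<nu>"
      by (auto simp: mv_range_def mv_add_def mv_scale_def)
    have "j - g = t\<^sub>0 *\<^sub>R (\<nu> - h)" using z(3) by (simp add: algebra_simps)
    then have "blinfun_apply (j - g) (x - z) = - (t\<^sub>0 * blinfun_apply (\<nu> - h) (z - x))"
      by (simp only: blinfun.scaleR_left blinfun.diff_right) (simp add: algebra_simps)
    also have "\<dots> \<le> 0" using related[OF z(2)] assms(6) by simp
    finally have "x = z" by (rule duality_map_strictly_monotone[OF uc p j z(1)])
    moreover from this have "j = g" using duality_map_unique[OF us] j z(1) by blast
    ultimately show ?thesis using z assms(6) by simp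
  qed
  have "f \<in> mv_range (mv_add (duality_map p) (mv_scale t A))" if t: "0 < t" for t f
  proof -
    \<comment> \<open>This is the graph of \<open>A\<close> scaled by \<open>t\<close> and
      translated by \<open>- f\<close>, which is again monotone.\<close>
    define Gr where "Gr = {(y, t *\<^sub>R \<nu> - f) | y \<nu>. \<nu> \<in> A y}"
    obtain \<nu>0 where "\<nu>0 \<in> A 0" using ne by blast
    then have "(0, t *\<^sub>R \<nu>0 - f) \<in> Gr" by (auto simp: Gr_def)
    moreover have "0 \<le> blinfun_apply (b - c) (y - z)" if gr: "(y, b) \<in> Gr" "(z, c) \<in> Gr" for y b z c
    proof -
      obtain \<mu> \<nu> where \<mu>\<nu>: "\<mu> \<in> A y" "\<nu> \<in> A z" and "b = t *\<^sub>R \<mu> - f" "c = t *\<^sub>R \<nu> - f"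
        using gr by (auto simp: Gr_def)
      then have "b - c = t *\<^sub>R (\<mu> - \<nu>)" by (simp add: scaleR_diff_right)
      then show ?thesis using mono[OF \<mu>\<nu>] t by (simp add: blinfun.scaleR_left)
    qed
    ultimately obtain x where "\<And>y b. (y, b) \<in> Gr \<Longrightarrow>
        blinfun_apply b x + norm x powr p / p \<le> blinfun_apply b y + norm y powr p / p"
      using monotone_variational_inequality[OF uc p] by blast
    then have x: "(t *\<^sub>R \<nu> - f) x + norm x powr p / p \<le> (t *\<^sub>R \<nu> - f) y + norm y powr p / p"
      if "\<nu> \<in> A y" for y \<nu> using that by (auto simp: Gr_def)
    obtain j where j: "j \<in> duality_map p x" and der:
      "\<And>v. ((\<lambda>s. norm (x + s *\<^sub>R v) powr p / p) has_real_derivative blinfun_apply j v) (at_right 0)"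
      using duality_map_right_derivative[OF us p] by blast
    \<comment> \<open>The only candidate: \<open>h\<close> solves
      \<open>f = j + t *\<^sub>R h\<close>.\<close>
    define h where "h = (1 / t) *\<^sub>R (f - j)"
    have "h \<in> A x"
    proof (rule maximal[OF _ j])
      fix y \<nu> assume \<nu>: "\<nu> \<in> A y"
      define v where "v = y - x"
      have "0 \<le> (t *\<^sub>R \<nu> - f) v + (norm (x + s *\<^sub>R v) powr p / p - norm x powr p / p) / s"
        if s: "0 < s" "s < 1" for s
      proof -
        \<comment> \<open>Monotonicity between \<open>x + s *\<^sub>R v\<close> and \<open>y\<close>
          replaces \<open>\<mu>\<close>, which varies with \<open>s\<close>, by the fixed
          \<open>\<nu>\<close>. The limit as \<open>s\<close> tends to 0 then involves no continuity
          of \<open>A\<close>.\<close>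
        obtain \<mu> where \<mu>: "\<mu> \<in> A (x + s *\<^sub>R v)" using ne by blast
        have "y - (x + s *\<^sub>R v) = (1 - s) *\<^sub>R v" by (simp add: v_def algebra_simps)
        then have "0 \<le> (1 - s) * (\<nu> - \<mu>) v"
          using mono[OF \<nu> \<mu>] by (simp add: blinfun.scaleR_right)
        then have "\<mu> v \<le> \<nu> v" using s by (simp add: zero_le_mult_iff blinfun.diff_left)
        have "0 \<le> s * (t *\<^sub>R \<mu> - f) v + (norm (x + s *\<^sub>R v) powr p / p - norm x powr p / p)"
          using x[OF \<mu>] by (simp add: blinfun.add_right blinfun.scaleR_right)
        then have "0 \<le> (s * (t *\<^sub>R \<mu> - f) v + (norm (x + s *\<^sub>R v) powr p / p - norm x powr p / p)) / s"
          using s by simp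
        also have "\<dots> = (t *\<^sub>R \<mu> - f) v + (norm (x + s *\<^sub>R v) powr p / p - norm x powr p / p) / s"
          using s by (simp add: add_divide_distrib)
        also have "(t *\<^sub>R \<mu> - f) v \<le> (t *\<^sub>R \<nu> - f) v"
          using \<open>\<mu> v \<le> \<nu> v\<close> t by (simp add: blinfun.diff_left blinfun.scaleR_left)
        finally show ?thesis by simp
      qed
      then have "\<forall>\<^sub>F s in at_right 0.
          0 \<le> (t *\<^sub>R \<nu> - f) v + (norm (x + s *\<^sub>R v) powr p / p - norm x powr p / p) / s"
        by (intro eventually_at_rightI[of 0 1]) auto
      moreover have "((\<lambda>s. (t *\<^sub>R \<nu> - f) v + (norm (x + s *\<^sub>R v) powr p / p - norm x powr p / p) / s)
          \<longlongrightarrow> (t *\<^sub>R \<nu> - f) v + j v) (at_right 0)"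
        using der[of v] by (intro tendsto_intros) (simp add: has_field_derivative_iff)
      ultimately have "0 \<le> (t *\<^sub>R \<nu> - f) v + j v"
        by (intro tendsto_lowerbound[of _ _ "at_right 0"]) auto
      moreover have "(t *\<^sub>R \<nu> - f) + j = t *\<^sub>R (\<nu> - h)"
        using t by (simp add: h_def scaleR_diff_right)
      ultimately have "0 \<le> t * (\<nu> - h) v"
        by (metis blinfun.add_left blinfun.scaleR_left real_scaleR_def)
      then show "0 \<le> (\<nu> - h) (y - x)" using t by (simp add: zero_le_mult_iff v_def)
    qed
    moreover have "f = j + t *\<^sub>R h" using t by (simp add: h_def)
    ultimately show ?thesis
      using j by (auto simp: mv_range_def mv_add_def mv_scale_def)
  qed
  then show ?thesis unfolding range_condition_def by blast
qed

end
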